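(* Let $X$ and $Y$ be extended metric spaces with points at infinity $*_X$ and $*_Y$ respectively, and let $o\in X$, $o'\in Y$ be finite points (origins). Let $X$ be asymptotically chained, and assume that all asymptotic cones of $X$ and $Y$ are $\operatorname{CAT}(0)$-spaces. If there exists a regular AM-map (at infinity) $f:(X,o,*_X)\to(Y,o',*_Y)$, then $$\operatorname{tele-dim}(X)\le\operatorname{tele-dim}(Y).$$
   Context: Extended metric: a function $d:X\times X\to[0,\infty]$ for which there is at most one point $*_X$ (point at infinity) with $d(x,*_X)=\infty$ for $x\ne*_X$, $d( *_X,*_X)=0$, and whose restriction to $X_*=X\setminus\{*_X\}$ (the finite points) is a metric. If $*_X$ exists, $X_*$ is assumed unbounded. Topology on $X$: base given by open balls of $X_*$ and sets $\{*_X\}\cup(X\setminus\overline{B(x,r)})$, $x\in X_*$, $r>0$. With origin $o$, write $|x|=d(o,x)$. Maps $(X,o,*_X)\to(Y,o',*_Y)$ satisfy $f(o)=o'$, $f( *_X)=*_Y$. Cross ratio. For $x\ne w$, $y\ne z$ finite, $[x,y,z,w]=\frac{d(x,z)d(y,w)}{d(x,w)d(y,z)}$. If $x=z$ or $y=w$ it is $0$ (even if some points are at infinity); otherwise factors containing the point at infinity are omitted, e.g. $[x,y,z,*_X]=d(x,z)/d(y,z)$. Admissible gauge: nondecreasing $u:\mathbb R_+\to\mathbb R$ with $\limsup_{r\to\infty}u(r)/r=0$. Finite points $x,y$ are separated by $u$ if $d(x,y)>u(|x|+|y|)$; every finite point is separated from $*_X$. AM-map at infinity: there are an admissible gauge $u$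 and a homeomorphism $\eta:[0,\infty)\to[0,\infty)$ with $[f(x),f(y),f(z),f(w)]<\eta([x,y,z,w])$ for all $x,y,z,w\in X$ pairwise separated by $u$ (the condition includes that the cross ratios involved are defined). Regular: $f$ is continuous at $*_X$ and for every neighborhood $V$ of $*_X$ there is a neighborhood $U$ of $*_Y$ with $f^{-1}(U)\subset V$. Asymptotically chained: there is an admissible gauge $v$ such that any finite points $x,y\in X$ are joined by a chain $x_1=x,\dots,x_{k+1}=y$ with $\max_i d(x_i,x_{i+1})<v(|x|+|y|)$. Asymptotic cone. For a nonprincipal ultrafilter $\omega$ on $\mathbb N$ and a sequence of positive reals $\lambda_n$ with $\lim_\omega\lambda_n=\infty$, $\operatorname{Cone}^\omega_{\lambda_n}(X,o)$ is the set of sequences $\{x_n\}$ in $X$ with $\lim_\omega d(o,x_n)/\lambda_n<\infty$ modulo $D(x,y)=\lim_\omega d(x_n,y_n)/\lambda_n=0$, with metric $D$, together with a point at infinity represented by all sequences with $\lim_\omega d(o,x_n)/\lambda_n=\infty$. Metric properties such as $\operatorname{CAT}(0)$ and dimension refer to the space of finite points. The asymptotic cones of $X$ are all those obtained by varying $\omega$ and $\{\lambda_n\}$. Geometric dimension $\operatorname{geom-dim}(Z)$ of a $\operatorname{CAT}(0)$-space $Z$: the maximal topological (covering) dimension of compact subsets of $Z$. Telescopic dimension: if all asymptotic cones of $X$ are $\operatorname{CAT}(0)$, then $\operatorname{tele-dim}(X)\le n$ iff every asymptotic cone of $X$ has geometric dimension $\le n$; $\operatorname{tele-dim}(X)$ is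 the least such $n$ ($\infty$ if there is none). *)

theory Defs
  imports "HOL-Analysis.Analysis"
begin

section \<open>Extended metric spaces with a point at infinity\<close>

record 'a ext_space =
  points :: "'a set"
  edist :: "'a \<Rightarrow> 'a \<Rightarrow> ennreal"
  infpt :: 'a

definition finpts :: "('a, 'm) ext_space_scheme \<Rightarrow> 'a set" where
  "finpts X = points X - {infpt X}"

text \<open>The value \<open>0\<close> off the finite points is a dummy; it is needed because
  \<^locale>\<open>Metric_space\<close> requires symmetry and nonnegativity on the whole type.\<close>
definition fdist :: "('a, 'm) ext_space_scheme \<Rightarrow> 'a \<Rightarrow> 'a \<Rightarrow> real" where
  "fdist X x y = (if x \<in> finpts X \<and> y \<in> finpts X then enn2real (edist X x y) else 0)"

definition ext_metric_space :: "('a, 'm) ext_space_scheme \<Rightarrow> bool" where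
  "ext_metric_space X \<longleftrightarrow>
     infpt X \<in> points X \<and>
     edist X (infpt X) (infpt X) = 0 \<and>
     (\<forall>x\<in>finpts X. edist X x (infpt X) = \<infinity> \<and> edist X (infpt X) x = \<infinity>) \<and>
     (\<forall>x\<in>finpts X. \<forall>y\<in>finpts X. edist X x y < \<infinity>) \<and>
     Metric_space (finpts X) (fdist X) \<and>
     \<not> Metric_space.mbounded (finpts X) (fdist X) (finpts X)"

abbreviation fin_topology :: "('a, 'm) ext_space_scheme \<Rightarrow> 'a topology" where
  "fin_topology X \<equiv> Metric_space.mtopology (finpts X) (fdist X)"

abbreviation fin_ball :: "('a, 'm) ext_space_scheme \<Rightarrow> 'a \<Rightarrow> real \<Rightarrow> 'a set" where
  "fin_ball X \<equiv> Metric_space.mball (finpts X) (fdist X)"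

text \<open>The closure of a ball is taken in the metric space of finite points.\<close>
definition ext_topology :: "('a, 'm) ext_space_scheme \<Rightarrow> 'a topology" where
  "ext_topology X = topology_generated_by
     ({fin_ball X x r | x r. x \<in> finpts X \<and> r > 0} \<union>
      {insert (infpt X) (points X - fin_topology X closure_of fin_ball X x r) | x r.
         x \<in> finpts X \<and> r > 0})"

definition nbhd :: "'a topology \<Rightarrow> 'a \<Rightarrow> 'a set \<Rightarrow> bool" where
  "nbhd T a V \<longleftrightarrow> V \<subseteq> topspace T \<and> (\<exists>W. openin T W \<and> a \<in> W \<and> W \<subseteq> V)"


section \<open>Cross ratio, gauges and AM-maps\<close>

text \<open>Factors containing the point at infinity are omitted.\<close>
definition cr_factor :: "('a, 'm) ext_space_scheme \<Rightarrow> 'a \<Rightarrow> 'a \<Rightarrow> real" where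
  "cr_factor X x y = (if x = infpt X \<or> y = infpt X then 1 else fdist X x y)"

definition cross_ratio_defined :: "'a \<Rightarrow> 'a \<Rightarrow> 'a \<Rightarrow> 'a \<Rightarrow> bool" where
  "cross_ratio_defined x y z w \<longleftrightarrow> x \<noteq> w \<and> y \<noteq> z"

definition cross_ratio :: "('a, 'm) ext_space_scheme \<Rightarrow> 'a \<Rightarrow> 'a \<Rightarrow> 'a \<Rightarrow> 'a \<Rightarrow> real" where
  "cross_ratio X x y z w =
     (if x = z \<or> y = w then 0
      else (cr_factor X x z * cr_factor X y w) / (cr_factor X x w * cr_factor X y z))"

definition admissible_gauge :: "(real \<Rightarrow> real) \<Rightarrow> bool" where
  "admissible_gauge u \<longleftrightarrow>
     mono_on {0..} u \<and> Limsup at_top (\<lambda>r. ereal (u r / r)) = 0"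

text \<open>The point at infinity is not separated from itself.\<close>
definition separated ::
  "('a, 'm) ext_space_scheme \<Rightarrow> 'a \<Rightarrow> (real \<Rightarrow> real) \<Rightarrow> 'a \<Rightarrow> 'a \<Rightarrow> bool" where
  "separated X oX u x y \<longleftrightarrow>
     (x \<in> finpts X \<and> y \<in> finpts X \<and> fdist X x y > u (fdist X oX x + fdist X oX y)) \<or>
     (x \<in> finpts X \<and> y = infpt X) \<or>
     (x = infpt X \<and> y \<in> finpts X)"

definition pointed_map ::
  "('a, 'm) ext_space_scheme \<Rightarrow> 'a \<Rightarrow> ('b, 'n) ext_space_scheme \<Rightarrow> 'b \<Rightarrow> ('a \<Rightarrow> 'b) \<Rightarrow> bool" where
  "pointed_map X oX Y oY f \<longleftrightarrow>
     f \<in> points X \<rightarrow> points Y \<and> f oX = oY \<and> f (infpt X) = infpt Y"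

text \<open>That the cross ratios are defined is part of what is required of the map, not an extra
  restriction on the quadruples.\<close>
definition AM_map ::
  "('a, 'm) ext_space_scheme \<Rightarrow> 'a \<Rightarrow> ('b, 'n) ext_space_scheme \<Rightarrow> ('a \<Rightarrow> 'b) \<Rightarrow> bool" where
  "AM_map X oX Y f \<longleftrightarrow>
     (\<exists>u \<eta>. admissible_gauge u \<and> (\<exists>\<eta>'. homeomorphism {0..} {0..} \<eta> \<eta>') \<and>
       (\<forall>x\<in>points X. \<forall>y\<in>points X. \<forall>z\<in>points X. \<forall>w\<in>points X.
          separated X oX u x y \<and> separated X oX u x z \<and> separated X oX u x w \<and>
          separated X oX u y z \<and> separated X oX u y w \<and> separated X oX u z w \<longrightarrow>
            cross_ratio_defined x y z w \<and> cross_ratio_defined (f x) (f y) (f z) (f w) \<and>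
            cross_ratio Y (f x) (f y) (f z) (f w) < \<eta> (cross_ratio X x y z w)))"

definition regular_map ::
  "('a, 'm) ext_space_scheme \<Rightarrow> ('b, 'n) ext_space_scheme \<Rightarrow> ('a \<Rightarrow> 'b) \<Rightarrow> bool" where
  "regular_map X Y f \<longleftrightarrow>
     topcontinuous_at (ext_topology X) (ext_topology Y) f (infpt X) \<and>
     (\<forall>V. nbhd (ext_topology X) (infpt X) V \<longrightarrow>
        (\<exists>U. nbhd (ext_topology Y) (infpt Y) U \<and> f -` U \<inter> points X \<subseteq> V))"

definition asymptotically_chained :: "('a, 'm) ext_space_scheme \<Rightarrow> 'a \<Rightarrow> bool" where
  "asymptotically_chained X oX \<longleftrightarrow>
     (\<exists>v. admissible_gauge v \<and>
       (\<forall>x\<in>finpts X. \<forall>y\<in>finpts X. \<exists>k::nat. \<exists>c. k \<ge> 1 \<and> c ` {1..k+1} \<subseteq> finpts X \<and>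
          c 1 = x \<and> c (k+1) = y \<and>
          (\<forall>i\<in>{1..k}. fdist X (c i) (c (i+1)) < v (fdist X oX x + fdist X oX y))))"


section \<open>Asymptotic cones\<close>

definition nonprincipal_ultrafilter :: "nat filter \<Rightarrow> bool" where
  "nonprincipal_ultrafilter \<omega> \<longleftrightarrow>
     \<omega> \<noteq> bot \<and> (\<forall>P. eventually P \<omega> \<or> eventually (\<lambda>n. \<not> P n) \<omega>) \<and>
     (\<forall>n. \<omega> \<noteq> principal {n})"

definition cone_scale :: "nat filter \<Rightarrow> (nat \<Rightarrow> real) \<Rightarrow> bool" where
  "cone_scale \<omega> l \<longleftrightarrow> (\<forall>n. l n > 0) \<and> filterlim l at_top \<omega>"

text \<open>As \<^typ>\<open>ennreal\<close> is compact, this limit exists along every ultrafilter.\<close>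
definition seq_dist ::
  "('a, 'm) ext_space_scheme \<Rightarrow> nat filter \<Rightarrow> (nat \<Rightarrow> real) \<Rightarrow> (nat \<Rightarrow> 'a) \<Rightarrow> (nat \<Rightarrow> 'a) \<Rightarrow> ennreal" where
  "seq_dist X \<omega> l x y = Lim \<omega> (\<lambda>n. edist X (x n) (y n) / ennreal (l n))"

definition cone_rel ::
  "('a, 'm) ext_space_scheme \<Rightarrow> 'a \<Rightarrow> nat filter \<Rightarrow> (nat \<Rightarrow> real) \<Rightarrow> (nat \<Rightarrow> 'a) rel" where
  "cone_rel X oX \<omega> l = {(x, y). range x \<subseteq> points X \<and> range y \<subseteq> points X \<and>
     (let D = seq_dist X \<omega> l; b = (\<lambda>_. oX) in
        (D b x < \<infinity> \<and> D b y < \<infinity> \<and> D x y = 0) \<or> (D b x = \<infinity> \<and> D b y = \<infinity>))}"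

text \<open>Points are equivalence classes of sequences, the point at infinity being the class of all
  sequences at infinite distance from the origin. The case \<open>S = T\<close> only matters for that class.\<close>
definition asymptotic_cone ::
  "('a, 'm) ext_space_scheme \<Rightarrow> 'a \<Rightarrow> nat filter \<Rightarrow> (nat \<Rightarrow> real) \<Rightarrow> (nat \<Rightarrow> 'a) set ext_space" where
  "asymptotic_cone X oX \<omega> l =
     \<lparr> points = {x. range x \<subseteq> points X} // cone_rel X oX \<omega> l,
       edist = (\<lambda>S T. if S = T then 0
                      else seq_dist X \<omega> l (SOME x. x \<in> S) (SOME y. y \<in> T)),
       infpt = {x. range x \<subseteq> points X \<and> seq_dist X \<omega> l (\<lambda>_. oX) x = \<infinity>} \<rparr>"


section \<open>CAT(0) spaces\<close>

definition geodesic_segment :: "'a set \<Rightarrow> ('a \<Rightarrow> 'a \<Rightarrow> real) \<Rightarrow> 'a \<Rightarrow> 'a \<Rightarrow> 'a set \<Rightarrow> bool" where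
  "geodesic_segment M d x y S \<longleftrightarrow>
     (\<exists>c. c 0 = x \<and> c (d x y) = y \<and> S = c ` {0..d x y} \<and> S \<subseteq> M \<and>
       (\<forall>s\<in>{0..d x y}. \<forall>t\<in>{0..d x y}. d (c s) (c t) = \<bar>s - t\<bar>))"

definition comparison_on_side ::
  "('a \<Rightarrow> 'a \<Rightarrow> real) \<Rightarrow> 'a \<Rightarrow> 'a set \<Rightarrow> real^2 \<Rightarrow> real^2 \<Rightarrow> 'a \<Rightarrow> real^2 \<Rightarrow> bool" where
  "comparison_on_side d x S a b p p' \<longleftrightarrow>
     p \<in> S \<and> p' \<in> closed_segment a b \<and> dist a p' = d x p"

definition CAT0_space :: "'a set \<Rightarrow> ('a \<Rightarrow> 'a \<Rightarrow> real) \<Rightarrow> bool" where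
  "CAT0_space M d \<longleftrightarrow>
     Metric_space M d \<and>
     (\<forall>x\<in>M. \<forall>y\<in>M. \<exists>S. geodesic_segment M d x y S) \<and>
     (\<forall>x\<in>M. \<forall>y\<in>M. \<forall>z\<in>M. \<forall>S\<^sub>1 S\<^sub>2 S\<^sub>3.
        geodesic_segment M d x y S\<^sub>1 \<and> geodesic_segment M d y z S\<^sub>2 \<and> geodesic_segment M d z x S\<^sub>3 \<longrightarrow>
        (\<forall>a b c. dist a b = d x y \<and> dist b c = d y z \<and> dist c a = d z x \<longrightarrow>
          (let cmp = (\<lambda>p p'. comparison_on_side d x S\<^sub>1 a b p p' \<or>
                             comparison_on_side d y S\<^sub>2 b c p p' \<or>
                             comparison_on_side d z S\<^sub>3 c a p p')
           in \<forall>p p' q q'. cmp p p' \<and> cmp q q' \<longrightarrow> d p q \<le> dist p' q')))"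


section \<open>Dimensions\<close>

definition covering_dim_le :: "'a topology \<Rightarrow> nat \<Rightarrow> bool" where
  "covering_dim_le T n \<longleftrightarrow>
     (\<forall>\<U>. (\<forall>U\<in>\<U>. openin T U) \<and> \<Union>\<U> = topspace T \<longrightarrow>
       (\<exists>\<V>. (\<forall>V\<in>\<V>. openin T V) \<and> \<Union>\<V> = topspace T \<and> (\<forall>V\<in>\<V>. \<exists>U\<in>\<U>. V \<subseteq> U) \<and>
         (\<forall>x\<in>topspace T. finite {V\<in>\<V>. x \<in> V} \<and> card {V\<in>\<V>. x \<in> V} \<le> n + 1)))"

text \<open>Infinite if there is no bound. The empty space gets dimension \<open>0\<close> instead of \<open>-1\<close>, which
  does not affect the supremum over the compact subsets of a nonempty space.\<close>
definition covering_dim :: "'a topology \<Rightarrow> enat" where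
  "covering_dim T = (INF n\<in>{n. covering_dim_le T n}. enat n)"

definition geom_dim :: "'a set \<Rightarrow> ('a \<Rightarrow> 'a \<Rightarrow> real) \<Rightarrow> enat" where
  "geom_dim M d =
     (let T = Metric_space.mtopology M d in SUP K\<in>{K. compactin T K}. covering_dim (subtopology T K))"

definition all_cones_CAT0 :: "('a, 'm) ext_space_scheme \<Rightarrow> 'a \<Rightarrow> bool" where
  "all_cones_CAT0 X oX \<longleftrightarrow>
     (\<forall>\<omega> l. nonprincipal_ultrafilter \<omega> \<and> cone_scale \<omega> l \<longrightarrow>
        (let C = asymptotic_cone X oX \<omega> l in CAT0_space (finpts C) (fdist C)))"

definition tele_dim_le :: "('a, 'm) ext_space_scheme \<Rightarrow> 'a \<Rightarrow> nat \<Rightarrow> bool" where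
  "tele_dim_le X oX n \<longleftrightarrow>
     (\<forall>\<omega> l. nonprincipal_ultrafilter \<omega> \<and> cone_scale \<omega> l \<longrightarrow>
        (let C = asymptotic_cone X oX \<omega> l in geom_dim (finpts C) (fdist C) \<le> enat n))"

text \<open>Meaningful only for spaces all of whose asymptotic cones are CAT(0). The infimum of the
  empty set is \<open>\<infinity>\<close>.\<close>
definition tele_dim :: "('a, 'm) ext_space_scheme \<Rightarrow> 'a \<Rightarrow> enat" where
  "tele_dim X oX = (INF n\<in>{n. tele_dim_le X oX n}. enat n)"

end

theory Submission
  imports Defs
begin

text \<open>
  A cone of \<open>X\<close> with scales \<open>l\<^sub>n\<close> is mapped into the cone of \<open>Y\<close> along the same ultrafilter whose
  scales are \<open>m\<^sub>n = d(o', f(p\<^sub>n))\<close>, where \<open>p\<^sub>n\<close> represents a finite point other than the origin;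
  \<open>m\<^sub>n\<close> tends to infinity because \<open>f\<close> is continuous at infinity. Distinct points of the cone have
  eventually separated representatives since a gauge is sublinear, so the AM-condition with fourth
  point at infinity gives \<open>D(Fx, Fz) \<le> \<eta>(D(x, z) / D(y, z)) D(Fy, Fz)\<close>. Hence the induced map \<open>F\<close> is
  continuous, as \<open>\<eta>\<close> vanishes at \<open>0\<close>, and injective, as otherwise it would be constant although the
  images of the origin and of \<open>p\<close> are at distance \<open>1\<close>. Compact sets are therefore mapped
  homeomorphically, which bounds their covering dimension.
\<close>

section \<open>Covering dimension\<close>

text \<open>A cover of \<open>S\<close> is pushed forward along \<open>g\<close>, refined in
  \<open>T\<close>, and the refinement is pulled back by \<open>p\<close>. Multiplicity does not
  grow, since every pulled-back set around \<open>x\<close> comes from a member of \<open>V\<close>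
  around \<open>g x\<close>.\<close>

lemma covering_dim_le_homeomorphic_map:
  assumes g: "homeomorphic_map S T g" and T: "covering_dim_le T n"
  shows "covering_dim_le S n"
  unfolding covering_dim_le_def
proof (intro allI impI)
  fix U assume U: "(\<forall>V\<in>U. openin S V) \<and> \<Union>U = topspace S"
  have img: "g ` topspace S = topspace T" and inj: "inj_on g (topspace S)"
    using homeomorphic_imp_surjective_map[OF g] homeomorphic_imp_injective_map[OF g] .
  have "(\<forall>V\<in>(`) g ` U. openin T V) \<and> g ` \<Union>U = topspace T"
    using U img homeomorphic_map_openness_eq[OF g] by simp
  then have "(\<forall>V\<in>(`) g ` U. openin T V) \<and> \<Union>((`) g ` U) = topspace T"
    by (simp add: image_Union)
  then obtain V where V: "\<forall>W\<in>V. openin T W" "\<Union>V = topspace T" "\<forall>W\<in>V. \<exists>Z\<in>(`) g ` U. W \<subseteq> Z"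
    and fin: "\<forall>x\<in>topspace T. finite {W\<in>V. x \<in> W} \<and> card {W\<in>V. x \<in> W} \<le> n + 1"
    using T[unfolded covering_dim_le_def, rule_format, of "(`) g ` U"] by auto
  define p where "p W = {x \<in> topspace S. g x \<in> W}" for W
  have "\<forall>W\<in>p ` V. openin S W"
    using V(1) homeomorphic_imp_continuous_map[OF g] by (auto simp: p_def continuous_map_def)
  moreover have "\<Union>(p ` V) = topspace S"
    using V(2) img by (fastforce simp: p_def)
  moreover have "\<forall>W\<in>p ` V. \<exists>Z\<in>U. W \<subseteq> Z"
  proof
    fix W assume "W \<in> p ` V"
    then obtain W' where W': "W' \<in> V" "W = p W'" by blast
    with V(3) obtain Z where Z: "Z \<in> U" "W' \<subseteq> g ` Z" by blast
    have "Z \<subseteq> topspace S" using Z(1) U by blast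
    have "W \<subseteq> Z"
    proof
      fix x assume "x \<in> W"
      then have x: "x \<in> topspace S" "g x \<in> g ` Z" using W' Z by (auto simp: p_def)
      then show "x \<in> Z" using inj \<open>Z \<subseteq> topspace S\<close> by (simp add: inj_on_image_mem_iff)
    qed
    then show "\<exists>Z\<in>U. W \<subseteq> Z" using Z(1) by blast
  qed
  moreover have "\<forall>x\<in>topspace S. finite {W\<in>p ` V. x \<in> W} \<and> card {W\<in>p ` V. x \<in> W} \<le> n + 1"
  proof
    fix x assume x: "x \<in> topspace S"
    have sub: "{W\<in>p ` V. x \<in> W} \<subseteq> p ` {W\<in>V. g x \<in> W}" by (auto simp: p_def)
    have f: "finite {W\<in>V. g x \<in> W}" "card {W\<in>V. g x \<in> W} \<le> n + 1" using fin x img by blast+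
    have "card {W\<in>p ` V. x \<in> W} \<le> card (p ` {W\<in>V. g x \<in> W})"
      using f(1) sub by (intro card_mono) simp_all
    also have "\<dots> \<le> n + 1"
      using card_image_le[OF f(1), of p] f(2) by (rule le_trans)
    finally show "finite {W\<in>p ` V. x \<in> W} \<and> card {W\<in>p ` V. x \<in> W} \<le> n + 1"
      using finite_subset[OF sub] f(1) by simp
  qed
  ultimately show "\<exists>V. (\<forall>W\<in>V. openin S W) \<and> \<Union>V = topspace S \<and> (\<forall>W\<in>V. \<exists>Z\<in>U. W \<subseteq> Z) \<and>
      (\<forall>x\<in>topspace S. finite {W\<in>V. x \<in> W} \<and> card {W\<in>V. x \<in> W} \<le> n + 1)"
    by blast
qed

lemma covering_dim_homeomorphic_map_le:
  assumes "homeomorphic_map S T g"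
  shows "covering_dim S \<le> covering_dim T"
  unfolding covering_dim_def
  by (rule INF_superset_mono) (use covering_dim_le_homeomorphic_map[OF assms] in auto)

lemma covering_dim_subsingleton:
  assumes "topspace T \<subseteq> {a}"
  shows "covering_dim T = 0"
proof -
  have "covering_dim_le T 0"
    unfolding covering_dim_le_def
  proof (intro allI impI)
    fix U assume U: "(\<forall>V\<in>U. openin T V) \<and> \<Union>U = topspace T"
    \<comment> \<open>When \<open>T\<close> is empty, \<open>U\<close> may be the empty family,
      which offers no superset even for \<open>{}\<close>; hence the empty set is removed.\<close>
    let ?V = "{topspace T} - {{}}"
    have "\<forall>V\<in>?V. \<exists>Z\<in>U. V \<subseteq> Z"
    proof
      fix V assume "V \<in> ?V"
      then have V: "V = {a}" "a \<in> \<Union>U" using assms U by auto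
      then show "\<exists>Z\<in>U. V \<subseteq> Z" by blast
    qed
    moreover have "finite {V\<in>?V. x \<in> V} \<and> card {V\<in>?V. x \<in> V} \<le> 0 + 1" for x
      using card_mono[of "{topspace T}" "{V\<in>?V. x \<in> V}"] by auto
    ultimately show "\<exists>V. (\<forall>W\<in>V. openin T W) \<and> \<Union>V = topspace T \<and> (\<forall>W\<in>V. \<exists>Z\<in>U. W \<subseteq> Z) \<and>
        (\<forall>x\<in>topspace T. finite {W\<in>V. x \<in> W} \<and> card {W\<in>V. x \<in> W} \<le> 0 + 1)"
      by (intro exI[of _ ?V]) auto
  qed
  then have "covering_dim T \<le> enat 0"
    unfolding covering_dim_def by (intro INF_lower) simp
  then show ?thesis by (simp flip: zero_enat_def)
qed

text \<open>On a compact set a continuous injection into a Hausdorff space is a homeomorphism onto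
  its image. So each term of the supremum for \<open>M\<close> is bounded by the term of a compact
  subset of \<open>N\<close>.\<close>

lemma geom_dim_le_of_continuous_injection:
  assumes M: "Metric_space M d" and N: "Metric_space N d'"
    and g: "continuous_map (Metric_space.mtopology M d) (Metric_space.mtopology N d') g"
    and inj: "inj_on g M"
  shows "geom_dim M d \<le> geom_dim N d'"
  unfolding geom_dim_def Let_def
proof (rule SUP_least, clarify)
  interpret M: Metric_space M d by fact
  interpret N: Metric_space N d' by fact
  fix K assume K: "compactin M.mtopology K"
  have KM: "K \<subseteq> M" using K compactin_subset_topspace by fastforce
  have gK: "compactin N.mtopology (g ` K)" using image_compactin[OF K g] .
  have gKN: "g ` K \<subseteq> N" using gK compactin_subset_topspace by fastforce
  have "homeomorphic_map (subtopology M.mtopology K) (subtopology N.mtopology (g ` K)) g"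
  proof (rule continuous_imp_homeomorphic_map)
    show "continuous_map (subtopology M.mtopology K) (subtopology N.mtopology (g ` K)) g"
      using g by (intro continuous_map_into_subtopology continuous_map_from_subtopology) auto
    show "compact_space (subtopology M.mtopology K)"
      using K by (simp add: compact_space_subtopology)
    show "Hausdorff_space (subtopology N.mtopology (g ` K))"
      by (simp add: Hausdorff_space_subtopology N.Hausdorff_space_mtopology)
    show "g ` topspace (subtopology M.mtopology K) = topspace (subtopology N.mtopology (g ` K))"
      using KM gKN by (auto simp: Int_absorb1)
    show "inj_on g (topspace (subtopology M.mtopology K))"
      using inj by (rule inj_on_subset) auto
  qed
  then have "covering_dim (subtopology M.mtopology K) \<le> covering_dim (subtopology N.mtopology (g ` K))"
    by (rule covering_dim_homeomorphic_map_le)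
  also have "\<dots> \<le> (SUP K\<in>{K. compactin N.mtopology K}. covering_dim (subtopology N.mtopology K))"
    by (rule SUP_upper) (use gK in simp)
  finally show "covering_dim (subtopology M.mtopology K) \<le> \<dots>" .
qed

text \<open>Settles the cones whose only finite point is the origin, where no second point is
  available to define scales in the target.\<close>

lemma geom_dim_subsingleton:
  assumes "Metric_space M d" "M \<subseteq> {a}"
  shows "geom_dim M d = 0"
proof -
  interpret Metric_space M d by fact
  have "covering_dim (subtopology mtopology K) = 0" for K
    by (rule covering_dim_subsingleton[of _ a]) (use assms in auto)
  then have "(\<lambda>K. covering_dim (subtopology mtopology K)) = (\<lambda>K. 0)" by blast
  then show ?thesis unfolding geom_dim_def Let_def
    by (smt (verit) SUP_least bot_enat_def bot.extremum_uniqueI order_refl)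
qed

section \<open>Gauges and distortion functions\<close>

text \<open>Far out, the limit superior makes \<open>u r / r\<close> small; on the remaining bounded
  range monotonicity bounds \<open>u\<close>. The additive constant makes the estimate valid for all
  norms, including those that stay bounded.\<close>

lemma admissible_gauge_sublinear:
  assumes u: "admissible_gauge u" and "\<epsilon> > 0"
  shows "\<exists>c. \<forall>r\<ge>0. u r \<le> \<epsilon> * r + c"
proof -
  have "Limsup at_top (\<lambda>r. ereal (u r / r)) < ereal \<epsilon>"
    using assms by (simp add: admissible_gauge_def)
  then have "\<forall>\<^sub>F r in at_top. u r / r < \<epsilon>"
    by (drule_tac Limsup_lessD) simp
  then obtain N where N: "\<And>r. r \<ge> N \<Longrightarrow> u r / r < \<epsilon>"
    by (auto simp: eventually_at_top_linorder)
  define M where "M = max N 1"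
  have "u r \<le> \<epsilon> * r + \<bar>u M\<bar>" if "r \<ge> 0" for r
  proof (cases "r \<ge> M")
    case True
    then have "u r < \<epsilon> * r" using N[of r] by (simp add: M_def divide_less_eq)
    then show ?thesis by simp
  next
    case False
    then have "u r \<le> u M"
      using u that by (auto simp: admissible_gauge_def M_def intro!: mono_onD[of "{0..}" u])
    moreover have "0 \<le> \<epsilon> * r" using assms that by simp
    ultimately show ?thesis by simp
  qed
  then show ?thesis by blast
qed

text \<open>If the value 0 were taken at some \<open>a > 0\<close>, small positive values would be
  taken on both sides of \<open>a\<close>, against injectivity.\<close>

lemma homeomorphism_nonneg_reals_zero:
  fixes \<eta> :: "real \<Rightarrow> real"
  assumes "homeomorphism {0..} {0..} \<eta> \<eta>'"
  shows "\<eta> 0 = 0"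
proof (rule ccontr)
  assume n0: "\<eta> 0 \<noteq> 0"
  have cont: "continuous_on {0..} \<eta>" and img: "\<eta> ` {0..} = {0..}"
    and inv: "\<And>x. x \<ge> 0 \<Longrightarrow> \<eta>' (\<eta> x) = x"
    using assms by (auto simp: homeomorphism_def)
  have inj: "x = y" if "x \<ge> 0" "y \<ge> 0" "\<eta> x = \<eta> y" for x y using inv that by metis
  have "0 \<in> \<eta> ` {0..}" using img by simp
  then obtain a where a: "a \<ge> 0" "\<eta> a = 0" by auto
  have nn: "\<eta> x \<ge> 0" if "x \<ge> 0" for x using img that by auto
  have "a > 0" using a n0 by (cases "a = 0") auto
  \<comment> \<open>A positive level not above the values at either end of
    \<open>{0..a + 1}\<close>, so that the intermediate value theorem reaches it on both sides of
    \<open>a\<close>.\<close>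
  define k where "k = min (\<eta> 0) (\<eta> (a + 1))"
  have "\<eta> (a + 1) \<noteq> 0" using inj[of "a + 1" a] a by auto
  then have k: "k > 0" using nn[of 0] nn[of "a + 1"] n0 a by (auto simp: k_def)
  obtain s where s: "0 \<le> s" "s \<le> a" "\<eta> s = k"
    using IVT2'[of \<eta> a k 0] a k continuous_on_subset[OF cont, of "{0..a}"] by (auto simp: k_def)
  obtain t where t: "a \<le> t" "t \<le> a + 1" "\<eta> t = k"
    using IVT'[of \<eta> a k "a + 1"] a k continuous_on_subset[OF cont, of "{a..a + 1}"] by (auto simp: k_def)
  have "s = t" using inj s t a by auto
  then have "s = a" using s t by simp
  then show False using s a k by simp
qed

section \<open>Ultralimits and asymptotic cones\<close>

text \<open>Compactness gives a cluster point of the image filter, the ultrafilter property turns it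
  into a limit, and the Hausdorff property makes it the value chosen by \<open>Lim\<close>.\<close>

lemma tendsto_Lim_ultrafilter:
  fixes g :: "'i \<Rightarrow> 'c :: {t2_space}"
  assumes "compact (UNIV :: 'c set)" and nb: "F \<noteq> bot"
    and ultra: "\<And>P. eventually P F \<or> eventually (\<lambda>n. \<not> P n) F"
  shows "(g \<longlongrightarrow> Lim F g) F"
proof -
  have "filtermap g F \<noteq> bot" using nb by (simp add: filtermap_bot_iff)
  then obtain x where x: "inf (nhds x) (filtermap g F) \<noteq> bot"
    using assms(1) unfolding compact_filter by fastforce
  have "(g \<longlongrightarrow> x) F"
    unfolding filterlim_def
  proof (rule filter_leI)
    fix P assume P: "eventually P (nhds x)"
    show "eventually P (filtermap g F)"
    proof (rule ccontr)
      assume "\<not> eventually P (filtermap g F)"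
      then have "eventually (\<lambda>y. \<not> P y) (filtermap g F)"
        using ultra[of "\<lambda>n. P (g n)"] by (simp add: eventually_filtermap)
      with P have "eventually (\<lambda>_. False) (inf (nhds x) (filtermap g F))"
        unfolding eventually_inf by blast
      then show False using x by (simp add: eventually_False)
    qed
  qed
  then show ?thesis using tendsto_Lim nb by metis
qed

section \<open>Extended distances and neighbourhoods of infinity\<close>

lemma ext_space_edist_eq:
  assumes "ext_metric_space X" "x \<in> finpts X" "y \<in> finpts X"
  shows "edist X x y = ennreal (fdist X x y)"
  using assms by (simp add: ext_metric_space_def fdist_def)

lemma ext_space_edist_inf:
  assumes "ext_metric_space X" "x \<in> points X" "y \<in> points X" "x = infpt X \<or> y = infpt X" "x \<noteq> y"
  shows "edist X x y = \<infinity>"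
  using assms unfolding ext_metric_space_def finpts_def by blast

lemma ext_space_edist_self:
  assumes "ext_metric_space X" "x \<in> points X"
  shows "edist X x x = 0"
proof (cases "x = infpt X")
  case False
  then have x: "x \<in> finpts X" using assms by (simp add: finpts_def)
  interpret Metric_space "finpts X" "fdist X" using assms by (simp add: ext_metric_space_def)
  show ?thesis using ext_space_edist_eq[OF assms(1) x x] x by simp
qed (use assms in \<open>simp add: ext_metric_space_def\<close>)

lemma ext_space_edist_commute:
  assumes "ext_metric_space X" "x \<in> points X" "y \<in> points X"
  shows "edist X x y = edist X y x"
proof (cases "x = infpt X \<or> y = infpt X")
  case True
  then show ?thesis using assms ext_space_edist_inf by metis
next
  case False
  then have x: "x \<in> finpts X" "y \<in> finpts X" using assms by (auto simp add: finpts_def)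
  interpret Metric_space "finpts X" "fdist X" using assms by (simp add: ext_metric_space_def)
  show ?thesis using ext_space_edist_eq[OF assms(1)] x commute by simp
qed

lemma ext_space_edist_triangle:
  assumes "ext_metric_space X" "x \<in> points X" "y \<in> points X" "z \<in> points X"
  shows "edist X x z \<le> edist X x y + edist X y z"
proof (cases "x = infpt X \<or> y = infpt X \<or> z = infpt X")
  \<comment> \<open>Unless consecutive points coincide, the point at infinity is an end of one of
    the two steps and makes the right side infinite.\<close>
  case True
  then show ?thesis
    using assms ext_space_edist_inf[OF assms(1), of x y] ext_space_edist_inf[OF assms(1), of y z]
      ext_space_edist_self[OF assms(1), of x]
    by (cases "x = y"; cases "y = z") auto
next
  case False
  then have x: "x \<in> finpts X" "y \<in> finpts X" "z \<in> finpts X"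
    using assms by (auto simp add: finpts_def)
  interpret Metric_space "finpts X" "fdist X" using assms by (simp add: ext_metric_space_def)
  show ?thesis using ext_space_edist_eq[OF assms(1)] x triangle[OF x]
    by (simp flip: ennreal_plus add: ennreal_leI)
qed

text \<open>The topology is given by generators, so the claim is proved by induction on generation.
  The essential case is the complement of a closed ball, whose centre is moved to \<open>oX\<close>
  by the triangle inequality.\<close>

lemma ext_topology_neighbourhood_infpt:
  assumes X: "ext_metric_space X" and o: "oX \<in> finpts X"
    and W: "openin (ext_topology X) W" and inf: "infpt X \<in> W"
  shows "\<exists>R. \<forall>x\<in>finpts X. fdist X oX x > R \<longrightarrow> x \<in> W"
proof -
  interpret F: Metric_space "finpts X" "fdist X" using X by (simp add: ext_metric_space_def)
  let ?B = "{F.mball x r | x r. x \<in> finpts X \<and> r > 0} \<union>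
      {insert (infpt X) (points X - F.mtopology closure_of F.mball x r) | x r. x \<in> finpts X \<and> r > 0}"
  have "generate_topology_on ?B W"
    using W unfolding ext_topology_def openin_topology_generated_by_iff .
  then have "infpt X \<in> W \<longrightarrow> (\<exists>R. \<forall>x\<in>finpts X. fdist X oX x > R \<longrightarrow> x \<in> W)"
  proof induction
    case Empty
    then show ?case by simp
  next
    case (Int a b)
    show ?case
    proof
      assume "infpt X \<in> a \<inter> b"
      then obtain R R' where "\<forall>x\<in>finpts X. fdist X oX x > R \<longrightarrow> x \<in> a"
          "\<forall>x\<in>finpts X. fdist X oX x > R' \<longrightarrow> x \<in> b"
        using Int.IH by blast
      then have "\<forall>x\<in>finpts X. fdist X oX x > max R R' \<longrightarrow> x \<in> a \<inter> b" by simp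
      then show "\<exists>R. \<forall>x\<in>finpts X. fdist X oX x > R \<longrightarrow> x \<in> a \<inter> b" ..
    qed
  next
    case (UN K)
    then show ?case by (meson UnionE UnionI)
  next
    case (Basis s)
    show ?case
    proof
      assume i: "infpt X \<in> s"
      from Basis consider x r where "x \<in> finpts X" "s = F.mball x r"
        | x r where "x \<in> finpts X" "s = insert (infpt X) (points X - F.mtopology closure_of F.mball x r)"
        by blast
      then show "\<exists>R. \<forall>x\<in>finpts X. fdist X oX x > R \<longrightarrow> x \<in> s"
      proof cases
        case 1
        \<comment> \<open>This case is void: balls consist of finite points, so none contains
          \<open>infpt X\<close>.\<close>
        then show ?thesis using i F.mball_subset_mspace by (fastforce simp: finpts_def)
      next
        case (2 x r)
        have "y \<in> s" if y: "y \<in> finpts X" "fdist X oX y > fdist X oX x + r" for y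
        proof -
          have "y \<notin> F.mcball x r"
            using F.triangle[OF o 2(1) y(1)] y by (auto simp: F.mcball_def)
          then have "y \<notin> F.mtopology closure_of F.mball x r"
            using closure_of_minimal[OF F.mball_subset_mcball F.closedin_mcball] by blast
          then show ?thesis using y 2 by (auto simp: finpts_def)
        qed
        then show ?thesis by blast
      qed
    qed
  qed
  with inf show ?thesis by blast
qed

section \<open>Finite points and distances of a single cone\<close>

locale ultrascaled_space =
  fixes X :: "('a, 'm) ext_space_scheme" and b :: 'a and \<omega> :: "nat filter" and l :: "nat \<Rightarrow> real"
  assumes X: "ext_metric_space X" and b: "b \<in> finpts X"
    and \<omega>: "nonprincipal_ultrafilter \<omega>" and l: "cone_scale \<omega> l"
begin

sublocale fin: Metric_space "finpts X" "fdist X"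
  using X by (simp add: ext_metric_space_def)

abbreviation "D \<equiv> seq_dist X \<omega> l"
abbreviation "B \<equiv> (\<lambda>_::nat. b)"
abbreviation "C \<equiv> asymptotic_cone X b \<omega> l"
text \<open>These sequences represent the finite points of the cone. Single terms may still be
  \<open>infpt X\<close>, on a set of indices negligible for \<open>\<omega>\<close>.\<close>

definition finseqs :: "(nat \<Rightarrow> 'a) set" where
  "finseqs = {x. range x \<subseteq> points X \<and> D B x < \<infinity>}"

lemma nontrivial: "\<omega> \<noteq> bot"
  using \<omega> by (simp add: nonprincipal_ultrafilter_def)

lemma l_pos: "l n > 0"
  using l by (simp add: cone_scale_def)

lemma b_points: "range B \<subseteq> points X"
  using b by (auto simp: finpts_def)

lemma D_tendsto: "((\<lambda>n. edist X (x n) (y n) / ennreal (l n)) \<longlongrightarrow> D x y) \<omega>"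
  unfolding seq_dist_def
  by (rule tendsto_Lim_ultrafilter[OF compact_UNIV nontrivial])
    (use \<omega> in \<open>simp add: nonprincipal_ultrafilter_def\<close>)

lemma D_self:
  assumes "range x \<subseteq> points X" shows "D x x = 0"
proof -
  have "edist X (x n) (x n) = 0" for n using ext_space_edist_self[OF X] assms by auto
  then have "((\<lambda>n::nat. 0::ennreal) \<longlongrightarrow> D x x) \<omega>" using D_tendsto[of x x] by simp
  then show ?thesis using nontrivial tendsto_const tendsto_unique by blast
qed

lemma D_commute:
  assumes "range x \<subseteq> points X" "range y \<subseteq> points X" shows "D x y = D y x"
proof -
  have "edist X (x n) (y n) = edist X (y n) (x n)" for n
    by (rule ext_space_edist_commute[OF X]) (use assms in auto)
  then show ?thesis by (simp add: seq_dist_def)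
qed

lemma D_triangle:
  assumes "range x \<subseteq> points X" "range y \<subseteq> points X" "range z \<subseteq> points X"
  shows "D x z \<le> D x y + D y z"
proof (rule tendsto_le[OF nontrivial tendsto_add[OF D_tendsto D_tendsto] D_tendsto])
  have "edist X (x n) (z n) / ennreal (l n) \<le>
    edist X (x n) (y n) / ennreal (l n) + edist X (y n) (z n) / ennreal (l n)" for n
    unfolding add_divide_distrib_ennreal[symmetric]
    by (intro divide_right_mono_ennreal ext_space_edist_triangle[OF X]) (use assms in auto)
  then show "\<forall>\<^sub>F n in \<omega>. edist X (x n) (z n) / ennreal (l n) \<le>
    edist X (x n) (y n) / ennreal (l n) + edist X (y n) (z n) / ennreal (l n)" by simp
qed

lemma D_finite:
  assumes "x \<in> finseqs" "y \<in> finseqs" shows "D x y < \<infinity>"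
proof -
  have "D x y \<le> D B x + D B y"
    using D_triangle[of x B y] D_commute[of x B] assms b_points by (auto simp: finseqs_def)
  also have "\<dots> < \<infinity>" using assms by (simp add: finseqs_def)
  finally show ?thesis .
qed

lemma B_finseqs: "B \<in> finseqs"
  using D_self b_points by (simp add: finseqs_def)

lemma rel_iff:
  assumes "x \<in> finseqs"
  shows "(x, y) \<in> cone_rel X b \<omega> l \<longleftrightarrow> y \<in> finseqs \<and> D x y = 0"
  using assms by (auto simp: cone_rel_def finseqs_def Let_def)

lemma equiv_rel: "equiv {x. range x \<subseteq> points X} (cone_rel X b \<omega> l)"
proof (rule equivI)
  show "cone_rel X b \<omega> l \<subseteq> {x. range x \<subseteq> points X} \<times> {x. range x \<subseteq> points X}"
    by (auto simp: cone_rel_def)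
  show "refl_on {x. range x \<subseteq> points X} (cone_rel X b \<omega> l)"
    by (rule refl_onI) (auto simp: cone_rel_def Let_def D_self top.not_eq_extremum)
  show "sym (cone_rel X b \<omega> l)"
    by (rule symI) (auto simp: cone_rel_def Let_def D_commute)
  show "trans (cone_rel X b \<omega> l)"
  proof (rule transI)
    fix x y z assume "(x, y) \<in> cone_rel X b \<omega> l" "(y, z) \<in> cone_rel X b \<omega> l"
    then show "(x, z) \<in> cone_rel X b \<omega> l"
      using D_triangle[of x y z] by (auto simp: cone_rel_def Let_def)
  qed
qed

lemma class_in_finpts:
  assumes "x \<in> finseqs"
  shows "cone_rel X b \<omega> l `` {x} \<in> finpts C"
proof -
  have "x \<in> cone_rel X b \<omega> l `` {x}"
    using assms rel_iff D_self by (auto simp: finseqs_def)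
  moreover have "x \<notin> infpt C"
    using assms by (auto simp: asymptotic_cone_def finseqs_def)
  ultimately show ?thesis
    using assms by (auto simp: finpts_def asymptotic_cone_def finseqs_def intro!: quotientI)
qed

lemma finpts_cone_cases:
  assumes "S \<in> finpts C"
  obtains x where "x \<in> finseqs" "x \<in> S" "S = cone_rel X b \<omega> l `` {x}"
proof -
  from assms obtain x where x: "range x \<subseteq> points X" "S = cone_rel X b \<omega> l `` {x}"
    and ni: "S \<noteq> infpt C"
    by (auto simp: finpts_def asymptotic_cone_def elim!: quotientE)
  have "x \<in> S" using x equiv_rel equiv_class_self by fastforce
  moreover have "D B x < \<infinity>"
  proof (rule ccontr)
    assume "\<not> D B x < \<infinity>"
    then have "D B x = \<infinity>" using top.not_eq_extremum by (metis infinity_ennreal_def)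
    \<comment> \<open>All sequences at infinite distance from the origin are related, so the class
      of one of them is the whole point at infinity.\<close>
    then have "S = infpt C"
      using x unfolding x(2) by (auto simp: asymptotic_cone_def cone_rel_def Let_def)
    with ni show False ..
  qed
  ultimately show ?thesis using that x by (auto simp: finseqs_def)
qed

lemma member_finseqs:
  assumes "S \<in> finpts C" "x \<in> S" shows "x \<in> finseqs" "S = cone_rel X b \<omega> l `` {x}"
proof -
  obtain y where y: "y \<in> finseqs" "S = cone_rel X b \<omega> l `` {y}"
    using assms(1) finpts_cone_cases by metis
  then show "x \<in> finseqs" using assms(2) rel_iff by auto
  show "S = cone_rel X b \<omega> l `` {x}"
    using y assms(2) equiv_class_eq[OF equiv_rel] by simp
qed

lemma class_eq_iff:
  assumes "x \<in> finseqs" "y \<in> finseqs"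
  shows "cone_rel X b \<omega> l `` {x} = cone_rel X b \<omega> l `` {y} \<longleftrightarrow> D x y = 0"
proof -
  have "cone_rel X b \<omega> l `` {x} = cone_rel X b \<omega> l `` {y} \<longleftrightarrow> (x, y) \<in> cone_rel X b \<omega> l"
    using assms by (intro eq_equiv_class_iff[OF equiv_rel]) (auto simp: finseqs_def)
  then show ?thesis using rel_iff assms by simp
qed

text \<open>The cone is defined with representatives picked by \<open>SOME\<close>. Since
  \<open>D\<close> vanishes within a class, the triangle inequality allows any other
  representatives.\<close>

lemma fdist_cone:
  assumes S: "S \<in> finpts C" "x \<in> S" and T: "T \<in> finpts C" "y \<in> T"
  shows "fdist C S T = enn2real (D x y)"
proof -
  note x = member_finseqs[OF S] and y = member_finseqs[OF T]
  show ?thesis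
  proof (cases "S = T")
    case True
    then show ?thesis
      using x y class_eq_iff assms by (auto simp: fdist_def asymptotic_cone_def)
  next
    case False
    define x' y' where "x' = (SOME x. x \<in> S)" and "y' = (SOME y. y \<in> T)"
    have x': "x' \<in> S" and y': "y' \<in> T"
      unfolding x'_def y'_def using someI[of "\<lambda>x. x \<in> S", OF S(2)] someI[of "\<lambda>x. x \<in> T", OF T(2)] .
    note fs = x(1) y(1) member_finseqs(1)[OF S(1) x'] member_finseqs(1)[OF T(1) y']
    have pts: "range x \<subseteq> points X" "range y \<subseteq> points X" "range x' \<subseteq> points X" "range y' \<subseteq> points X"
      using fs by (auto simp: finseqs_def)
    have "D x x' = 0" "D y y' = 0"
      using x' y' fs rel_iff x(2) y(2) by auto
    then have "D x' y' = D x y"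
      using D_triangle[of x' x y] D_triangle[of x' y y'] D_triangle[of x x' y] D_triangle[of x' y' y]
        D_commute[of x x'] D_commute[of y y'] pts by auto
    then show ?thesis
      using False S T by (simp add: fdist_def asymptotic_cone_def x'_def y'_def)
  qed
qed

text \<open>A term equal to \<open>infpt X\<close> has infinite distance from \<open>b\<close> even
  after scaling, which a finite limit excludes for almost all indices.\<close>

lemma eventually_finite:
  assumes "x \<in> finseqs"
  shows "\<forall>\<^sub>F n in \<omega>. x n \<in> finpts X"
proof -
  have "\<forall>\<^sub>F n in \<omega>. edist X b (x n) / ennreal (l n) < \<infinity>"
    using order_tendstoD(2)[OF D_tendsto[of B x]] assms by (simp add: finseqs_def)
  then show ?thesis
  proof eventually_elim
    case (elim n)
    have "x n \<noteq> infpt X"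
    proof
      assume i: "x n = infpt X"
      then have "edist X b (x n) = \<infinity>"
        using X b by (simp add: ext_metric_space_def)
      with elim show False using l_pos[of n] by (simp add: ennreal_top_divide)
    qed
    then show ?case using assms by (auto simp: finseqs_def finpts_def)
  qed
qed

text \<open>\<open>enn2real\<close> is continuous at finite values. The real quotients agree with
  the extended ones only eventually, because \<open>fdist\<close> has a dummy value at
  infinity.\<close>

lemma scaled_fdist_tendsto:
  assumes x: "x \<in> finseqs" and y: "y \<in> finseqs"
  shows "((\<lambda>n. fdist X (x n) (y n) / l n) \<longlongrightarrow> enn2real (D x y)) \<omega>"
proof -
  have "((\<lambda>n. enn2real (edist X (x n) (y n) / ennreal (l n))) \<longlongrightarrow> enn2real (D x y)) \<omega>"
    by (rule tendsto_enn2real) (use D_tendsto D_finite[OF x y] in auto)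
  then show ?thesis
  proof (rule Lim_transform_eventually)
    show "\<forall>\<^sub>F n in \<omega>. enn2real (edist X (x n) (y n) / ennreal (l n)) = fdist X (x n) (y n) / l n"
      using eventually_finite[OF x] eventually_finite[OF y]
      by eventually_elim (simp add: ext_space_edist_eq[OF X] divide_ennreal l_pos less_imp_le)
  qed
qed

lemma finseqsI:
  assumes "range x \<subseteq> points X" and ev: "\<forall>\<^sub>F n in \<omega>. x n \<in> finpts X \<and> fdist X b (x n) \<le> c * l n"
  shows "x \<in> finseqs"
proof -
  have "D B x \<le> ennreal c"
  proof (rule tendsto_upperbound[OF D_tendsto _ nontrivial])
    show "\<forall>\<^sub>F n in \<omega>. edist X b (x n) / ennreal (l n) \<le> ennreal c"
      using ev
    proof eventually_elim
      case (elim n)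
      then have "edist X b (x n) / ennreal (l n) = ennreal (fdist X b (x n) / l n)"
        using ext_space_edist_eq[OF X b] by (simp add: divide_ennreal l_pos)
      also have "\<dots> \<le> ennreal c"
        using elim l_pos[of n] by (intro ennreal_leI) (simp add: divide_le_eq)
      finally show ?case .
    qed
  qed
  also have "\<dots> < \<infinity>" by simp
  finally show ?thesis using assms by (simp add: finseqs_def)
qed


text \<open>Norms grow at most linearly in \<open>l n\<close>, so the sublinear gauge is eventually
  smaller than the distance, which is close to \<open>t * l n\<close>.\<close>

lemma eventually_separated:
  assumes u: "admissible_gauge u" and x: "x \<in> finseqs" and y: "y \<in> finseqs"
    and pos: "enn2real (D x y) > 0"
  shows "\<forall>\<^sub>F n in \<omega>. separated X b u (x n) (y n)"
proof -
  define s where "s = enn2real (D B x) + enn2real (D B y)"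
  define t where "t = enn2real (D x y)"
  \<comment> \<open>Chosen so that \<open>\<epsilon> * (s + 1) = t / 3\<close>. The summand 1 keeps
    the denominator positive and gives room above the limit \<open>s\<close> of the scaled
    norms.\<close>
  define \<epsilon> where "\<epsilon> = t / (3 * (s + 1))"
  have s: "s \<ge> 0" by (simp add: s_def)
  have t: "t > 0" using pos by (simp add: t_def)
  have "\<epsilon> > 0" using s t by (simp add: \<epsilon>_def)
  then obtain c where c: "\<And>r. r \<ge> 0 \<Longrightarrow> u r \<le> \<epsilon> * r + c"
    using admissible_gauge_sublinear[OF u] by blast
  have "((\<lambda>n. fdist X b (x n) / l n + fdist X b (y n) / l n) \<longlongrightarrow> s) \<omega>"
    unfolding s_def by (intro tendsto_add scaled_fdist_tendsto x y B_finseqs)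
  then have "\<forall>\<^sub>F n in \<omega>. fdist X b (x n) / l n + fdist X b (y n) / l n < s + 1"
    by (rule order_tendstoD) simp
  moreover have "\<forall>\<^sub>F n in \<omega>. fdist X (x n) (y n) / l n > 2 * t / 3"
    using order_tendstoD(1)[OF scaled_fdist_tendsto[OF x y], of "2 * t / 3"] t by (simp add: t_def)
  \<comment> \<open>Makes the additive constant \<open>c\<close> smaller than another
    \<open>t / 3 * l n\<close>.\<close>
  moreover have "\<forall>\<^sub>F n in \<omega>. l n > 3 * c / t"
    using l by (simp add: cone_scale_def filterlim_at_top_dense)
  ultimately show ?thesis
    using eventually_finite[OF x] eventually_finite[OF y]
  proof eventually_elim
    case (elim n)
    have ln: "l n > 0" by (rule l_pos)
    have "fdist X b (x n) + fdist X b (y n) < (s + 1) * l n"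
      using elim(1) ln by (simp add: field_simps)
    then have "\<epsilon> * (fdist X b (x n) + fdist X b (y n)) \<le> \<epsilon> * ((s + 1) * l n)"
      using \<open>\<epsilon> > 0\<close> by simp
    also have "\<dots> = t / 3 * l n" using s by (simp add: \<epsilon>_def field_simps)
    finally have "u (fdist X b (x n) + fdist X b (y n)) \<le> t / 3 * l n + c"
      using c[of "fdist X b (x n) + fdist X b (y n)"] by simp
    moreover have "c < t / 3 * l n" using elim(3) t by (simp add: field_simps)
    moreover have "2 * t / 3 * l n < fdist X (x n) (y n)"
      using elim(2) ln by (simp add: field_simps)
    ultimately have "u (fdist X b (x n) + fdist X b (y n)) < fdist X (x n) (y n)"
      by simp
    then show ?case using elim by (simp add: separated_def)
  qed
qed

end

section \<open>The map induced between cones\<close>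

text \<open>Taking \<open>infpt X\<close> as fourth point removes two factors of the cross ratio and
  leaves a quotient of distances. The gauge \<open>u\<close> and the function \<open>\<eta>\<close>
  are fixed here so that one choice serves all triples.\<close>

lemma AM_map_quasisymmetric:
  assumes X: "ext_metric_space X" and f: "pointed_map X oX Y oY f"
    and AM: "\<And>x y z w. x \<in> points X \<Longrightarrow> y \<in> points X \<Longrightarrow> z \<in> points X \<Longrightarrow> w \<in> points X \<Longrightarrow>
      separated X oX u x y \<and> separated X oX u x z \<and> separated X oX u x w \<and>
      separated X oX u y z \<and> separated X oX u y w \<and> separated X oX u z w \<Longrightarrow>
        cross_ratio_defined x y z w \<and> cross_ratio_defined (f x) (f y) (f z) (f w) \<and>
        cross_ratio Y (f x) (f y) (f z) (f w) < \<eta> (cross_ratio X x y z w)"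
    and fin: "x \<in> finpts X" "y \<in> finpts X" "z \<in> finpts X"
    and sep: "separated X oX u x y" "separated X oX u x z" "separated X oX u y z"
  shows "f x \<in> finpts Y" "f y \<in> finpts Y" "f z \<in> finpts Y"
    and "f y \<noteq> f z"
    and "fdist Y (f x) (f z) / fdist Y (f y) (f z) < \<eta> (fdist X x z / fdist X y z)"
proof -
  interpret Metric_space "finpts X" "Defs.fdist X" using X by (simp add: ext_metric_space_def)
  have inf: "infpt X \<in> points X" using X by (simp add: ext_metric_space_def)
  have pts: "x \<in> points X" "y \<in> points X" "z \<in> points X" using fin by (auto simp: finpts_def)
  have ninf: "x \<noteq> infpt X" "y \<noteq> infpt X" "z \<noteq> infpt X" using fin by (auto simp: finpts_def)
  have sep': "separated X oX u y x" "separated X oX u z x" "separated X oX u z y"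
    using sep fin ninf by (auto simp: separated_def commute add.commute)
  have sepi: "separated X oX u x (infpt X)" "separated X oX u y (infpt X)" "separated X oX u z (infpt X)"
    using fin by (auto simp: separated_def)
  have fi: "f (infpt X) = infpt Y" and fp: "f x \<in> points Y" "f y \<in> points Y" "f z \<in> points Y"
    using f pts by (auto simp: pointed_map_def)
  \<comment> \<open>Definedness only says that the outer and the inner image points differ. Three
    orders of the triple yield all the distinctness and finiteness of the images.\<close>
  note 1 = AM[OF pts inf] and 2 = AM[OF pts(2) pts(1) pts(3) inf] and 3 = AM[OF pts(3) pts(1) pts(2) inf]
  have ne: "f x \<noteq> infpt Y" "f y \<noteq> infpt Y" "f z \<noteq> infpt Y" "x \<noteq> z" "f x \<noteq> f z" "f y \<noteq> f z"
    using 1 2 3 sep sep' sepi fi by (auto simp: cross_ratio_defined_def)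
  then show "f x \<in> finpts Y" "f y \<in> finpts Y" "f z \<in> finpts Y" "f y \<noteq> f z"
    using fp by (auto simp: finpts_def)
  show "Defs.fdist Y (f x) (f z) / Defs.fdist Y (f y) (f z) <
      \<eta> (Defs.fdist X x z / Defs.fdist X y z)"
    using 1 sep sepi ne ninf fi by (simp add: cross_ratio_def cr_factor_def)
qed

lemma regular_map_tendsto_infinity:
  assumes X: "ext_metric_space X" and Y: "ext_metric_space Y"
    and oX: "oX \<in> finpts X" and oY: "oY \<in> finpts Y"
    and f: "f (infpt X) = infpt Y" and reg: "regular_map X Y f"
  shows "\<exists>R. \<forall>x\<in>finpts X. R < fdist X oX x \<longrightarrow> f x \<in> finpts Y \<longrightarrow> K \<le> fdist Y oY (f x)"
proof -
  interpret F: Metric_space "finpts Y" "fdist Y" using Y by (simp add: ext_metric_space_def)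
  \<comment> \<open>The complement of a closed ball, a basic neighbourhood of infinity; the radius
    \<open>\<bar>K\<bar> + 1\<close> is positive for every \<open>K\<close>.\<close>
  define V where "V = insert (infpt Y) (points Y - F.mtopology closure_of F.mball oY (\<bar>K\<bar> + 1))"
  have "openin (ext_topology Y) V"
    unfolding ext_topology_def V_def
    by (rule topology_generated_by_Basis) (use oY in fastforce)
  moreover have "f (infpt X) \<in> V" using f by (simp add: V_def)
  ultimately obtain W where W: "openin (ext_topology X) W" "infpt X \<in> W" "\<And>x. x \<in> W \<Longrightarrow> f x \<in> V"
    using reg[unfolded regular_map_def topcontinuous_at_def, THEN conjunct1, THEN conjunct2,
        THEN conjunct2, rule_format, of V] by blast
  obtain R where R: "\<forall>x\<in>finpts X. fdist X oX x > R \<longrightarrow> x \<in> W"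
    using ext_topology_neighbourhood_infpt[OF X oX W(1,2)] by blast
  have "K \<le> fdist Y oY (f x)" if x: "x \<in> finpts X" "R < fdist X oX x" "f x \<in> finpts Y" for x
  proof -
    have "f x \<in> V" using W(3) R x by blast
    then have "f x \<notin> F.mtopology closure_of F.mball oY (\<bar>K\<bar> + 1)"
      using x(3) by (auto simp: V_def finpts_def)
    then have "f x \<notin> F.mball oY (\<bar>K\<bar> + 1)"
      using closure_of_subset[of "F.mball oY (\<bar>K\<bar> + 1)" F.mtopology] F.mball_subset_mspace by auto
    then show ?thesis using x(3) oY by simp
  qed
  then show ?thesis by blast
qed

text \<open>The scales of the target cone are constructed from the map, so \<open>CY\<close> is
  stated for all of them. The point given by \<open>nontriv\<close> fixes the normalisation.\<close>

lemma regular_AM_map_cone_embedding: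
  assumes X: "ext_metric_space X" and Y: "ext_metric_space Y"
    and oX: "oX \<in> finpts X" and oY: "oY \<in> finpts Y"
    and f: "pointed_map X oX Y oY f" and AM: "AM_map X oX Y f" and reg: "regular_map X Y f"
    and \<omega>: "nonprincipal_ultrafilter \<omega>" and l: "cone_scale \<omega> l"
    and CX: "CAT0_space (finpts (asymptotic_cone X oX \<omega> l)) (fdist (asymptotic_cone X oX \<omega> l))"
    and CY: "\<And>m. cone_scale \<omega> m \<Longrightarrow>
      Metric_space (finpts (asymptotic_cone Y oY \<omega> m)) (fdist (asymptotic_cone Y oY \<omega> m))"
    and nontriv: "\<not> finpts (asymptotic_cone X oX \<omega> l) \<subseteq> {cone_rel X oX \<omega> l `` {\<lambda>_. oX}}"
  shows "\<exists>m g. cone_scale \<omega> m \<and> inj_on g (finpts (asymptotic_cone X oX \<omega> l)) \<and>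
    continuous_map (fin_topology (asymptotic_cone X oX \<omega> l)) (fin_topology (asymptotic_cone Y oY \<omega> m)) g"
proof -
  interpret A: ultrascaled_space X oX \<omega> l by unfold_locales fact+
  interpret MC: Metric_space "finpts A.C" "fdist A.C"
    using CX by (simp add: CAT0_space_def)
  let ?d = "fdist A.C"
  obtain u \<eta> \<eta>' where u: "admissible_gauge u" and \<eta>: "homeomorphism {0..} {0..} \<eta> \<eta>'"
    and AM: "\<And>x y z w. x \<in> points X \<Longrightarrow> y \<in> points X \<Longrightarrow> z \<in> points X \<Longrightarrow> w \<in> points X \<Longrightarrow>
      separated X oX u x y \<and> separated X oX u x z \<and> separated X oX u x w \<and>
      separated X oX u y z \<and> separated X oX u y w \<and> separated X oX u z w \<Longrightarrow>
        cross_ratio_defined x y z w \<and> cross_ratio_defined (f x) (f y) (f z) (f w) \<and>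
        cross_ratio Y (f x) (f y) (f z) (f w) < \<eta> (cross_ratio X x y z w)"
    using AM unfolding AM_map_def by blast
  have \<eta>c: "continuous_on {0..} \<eta>" using \<eta> by (simp add: homeomorphism_def)
  have \<eta>0: "\<eta> 0 = 0" using homeomorphism_nonneg_reals_zero[OF \<eta>] .
  define N where "N = cone_rel X oX \<omega> l `` {A.B}"
  have N: "N \<in> finpts A.C" unfolding N_def by (intro A.class_in_finpts A.B_finseqs)
  obtain P where P: "P \<in> finpts A.C" "P \<noteq> N" using nontriv by (auto simp: N_def)
  have dOP: "?d N P > 0" using N P by (simp add: MC.mdist_pos_eq)
  \<comment> \<open>The cross ratio estimate needs three distinct points; the midpoint of a geodesic
    from \<open>N\<close> to \<open>P\<close> is the third.\<close>
  obtain Z where Z: "Z \<in> finpts A.C" "Z \<noteq> N" "Z \<noteq> P"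
  proof -
    obtain c where c: "c 0 = N" "c (?d N P) = P" "c ` {0..?d N P} \<subseteq> finpts A.C"
      "\<forall>s\<in>{0..?d N P}. \<forall>t\<in>{0..?d N P}. ?d (c s) (c t) = \<bar>s - t\<bar>"
      using CX N P unfolding CAT0_space_def geodesic_segment_def by meson
    define Z where "Z = c (?d N P / 2)"
    have ZC: "Z \<in> finpts A.C" using c(3) dOP by (auto simp: Z_def)
    have "?d N Z > 0" "?d Z P > 0"
      using c(4)[rule_format, of 0 "?d N P / 2"] c(4)[rule_format, of "?d N P / 2" "?d N P"] dOP c(1,2)
      by (auto simp: Z_def)
    then show ?thesis using that[OF ZC] ZC N P by (auto simp: MC.mdist_pos_eq)
  qed
  \<comment> \<open>Choosing one representative per class, with the constant sequence for the origin, makes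
    distinct classes eventually separated and spares the well-definedness of the induced map.\<close>
  define r where "r S = (if S = N then A.B else SOME x. x \<in> S)" for S
  have rO: "r N = A.B" by (simp add: r_def)
  have rS: "r S \<in> S" if "S \<in> finpts A.C" for S
  proof (cases "S = N")
    case True
    have "A.B \<in> N" using A.rel_iff A.B_finseqs A.D_self[OF A.b_points] by (simp add: N_def)
    then show ?thesis by (simp add: True rO)
  next
    case False
    then show ?thesis using A.finpts_cone_cases[OF that] someI_ex[of "\<lambda>x. x \<in> S"] by (auto simp: r_def)
  qed
  have rfin: "r S \<in> A.finseqs" if "S \<in> finpts A.C" for S
    using A.member_finseqs(1)[OF that rS[OF that]] .
  have rpts: "r S n \<in> points X" if "S \<in> finpts A.C" for S n
    using rfin[OF that] by (auto simp: A.finseqs_def)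
  have d: "?d S T = enn2real (A.D (r S) (r T))" if "S \<in> finpts A.C" "T \<in> finpts A.C" for S T
    using A.fdist_cone rS that by simp
  have lim: "((\<lambda>n. fdist X (r S n) (r T n) / l n) \<longlongrightarrow> ?d S T) \<omega>"
    if "S \<in> finpts A.C" "T \<in> finpts A.C" for S T
    unfolding d[OF that] by (intro A.scaled_fdist_tendsto rfin that)
  have sep: "\<forall>\<^sub>F n in \<omega>. separated X oX u (r S n) (r T n)"
    if "S \<in> finpts A.C" "T \<in> finpts A.C" "S \<noteq> T" for S T
    using that d MC.mdist_pos_eq[OF that(1,2)] by (intro A.eventually_separated u rfin) auto
  have triple: "\<forall>\<^sub>F n in \<omega>. f (r S n) \<in> finpts Y \<and> f (r T n) \<in> finpts Y \<and> f (r Q n) \<in> finpts Y \<and>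
      f (r T n) \<noteq> f (r Q n) \<and>
      fdist Y (f (r S n)) (f (r Q n)) / fdist Y (f (r T n)) (f (r Q n)) <
        \<eta> (fdist X (r S n) (r Q n) / fdist X (r T n) (r Q n))"
    if "S \<in> finpts A.C" "T \<in> finpts A.C" "Q \<in> finpts A.C" "S \<noteq> T" "S \<noteq> Q" "T \<noteq> Q" for S T Q
    using sep[OF that(1,2,4)] sep[OF that(1,3,5)] sep[OF that(2,3,6)]
      A.eventually_finite[OF rfin[OF that(1)]] A.eventually_finite[OF rfin[OF that(2)]]
      A.eventually_finite[OF rfin[OF that(3)]]
  proof eventually_elim
    case (elim n)
    show ?case using AM_map_quasisymmetric[OF X f AM elim(4,5,6,1,2,3)] by blast
  qed
  have ratio: "((\<lambda>n. \<eta> (fdist X (r S n) (r Q n) / fdist X (r T n) (r Q n))) \<longlongrightarrow> \<eta> (?d S Q / ?d T Q)) \<omega>"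
    if "S \<in> finpts A.C" "T \<in> finpts A.C" "Q \<in> finpts A.C" "T \<noteq> Q" for S T Q
  proof (rule continuous_on_tendsto_compose[OF \<eta>c])
    \<comment> \<open>Dividing numerator and denominator by \<open>l n\<close> does not change the
      quotient but makes both converge, the denominator to a nonzero limit.\<close>
    have "?d T Q \<noteq> 0" using MC.mdist_pos_eq that by force
    then have "((\<lambda>n. (fdist X (r S n) (r Q n) / l n) / (fdist X (r T n) (r Q n) / l n))
        \<longlongrightarrow> ?d S Q / ?d T Q) \<omega>"
      by (intro tendsto_divide lim that)
    then show "((\<lambda>n. fdist X (r S n) (r Q n) / fdist X (r T n) (r Q n)) \<longlongrightarrow> ?d S Q / ?d T Q) \<omega>"
      using A.l_pos by (simp add: less_imp_neq[THEN not_sym])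
  qed auto
  define a where "a n = fdist Y oY (f (r P n))" for n
  \<comment> \<open>A scale must be positive at every index. The default 1 occurs only where
    \<open>a n\<close> is 0, which \<open>am\<close> shows to be negligible.\<close>
  define m where "m n = (if a n > 0 then a n else 1)" for n
  have fPfin: "\<forall>\<^sub>F n in \<omega>. f (r P n) \<in> finpts Y"
    using triple[OF P(1) N Z(1) P(2) not_sym[OF Z(3)] not_sym[OF Z(2)]] by eventually_elim blast
  \<comment> \<open>Representatives of \<open>P\<close> leave every ball of \<open>X\<close>, being
    at distance more than a fixed multiple of \<open>l n\<close> from \<open>oX\<close>; continuity
    at infinity transfers this to \<open>Y\<close>.\<close>
  have a_large: "\<forall>\<^sub>F n in \<omega>. K \<le> a n" for K
  proof -
    obtain R where R: "\<forall>x\<in>finpts X. R < fdist X oX x \<longrightarrow> f x \<in> finpts Y \<longrightarrow> K \<le> fdist Y oY (f x)"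
      using regular_map_tendsto_infinity[OF X Y oX oY _ reg] f unfolding pointed_map_def by blast
    have "\<forall>\<^sub>F n in \<omega>. fdist X oX (r P n) / l n > ?d N P / 2"
      using order_tendstoD(1)[OF lim[OF N P(1)], of "?d N P / 2"] dOP by (simp add: rO)
    moreover have "\<forall>\<^sub>F n in \<omega>. l n > R / (?d N P / 2)"
      using l by (simp add: cone_scale_def filterlim_at_top_dense)
    ultimately show ?thesis
      using fPfin A.eventually_finite[OF rfin[OF P(1)]]
    proof eventually_elim
      case (elim n)
      have "R < ?d N P / 2 * l n" using elim(2) dOP by (simp add: field_simps)
      also have "\<dots> < fdist X oX (r P n)" using elim(1) A.l_pos[of n] by (simp add: field_simps)
      finally show ?case using R elim by (simp add: a_def)
    qed
  qed
  have am: "\<forall>\<^sub>F n in \<omega>. m n = a n \<and> a n > 0"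
    using a_large[of 1] by eventually_elim (simp add: m_def)
  have m: "cone_scale \<omega> m"
    unfolding cone_scale_def
  proof
    show "filterlim m at_top \<omega>"
      unfolding filterlim_at_top
    proof
      fix K show "\<forall>\<^sub>F n in \<omega>. K \<le> m n" using a_large[of K] am by eventually_elim simp
    qed
  qed (simp add: m_def)
  interpret E: ultrascaled_space Y oY \<omega> m by unfold_locales fact+
  interpret ME: Metric_space "finpts E.C" "fdist E.C" using CY m .
  let ?e = "fdist E.C"
  define h where "h S = (\<lambda>n. f (r S n))" for S
  have hO: "h N = E.B" using f by (simp add: h_def rO pointed_map_def)
  have hpts: "range (h S) \<subseteq> points Y" if "S \<in> finpts A.C" for S
    using rpts[OF that] f by (auto simp: h_def pointed_map_def)
  have hfin: "h S \<in> E.finseqs" if S: "S \<in> finpts A.C" for S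
  proof -
    \<comment> \<open>The origin is trivial, \<open>P\<close> has scaled norm at most 1 by the
      choice of \<open>m\<close>, and any other point is compared with \<open>P\<close> as seen from
      \<open>N\<close>.\<close>
    consider "S = N" | "S = P" | "S \<noteq> N" "S \<noteq> P" by blast
    then show ?thesis
    proof cases
      case 1
      then show ?thesis using hO E.B_finseqs by simp
    next
      case 2
      have "\<forall>\<^sub>F n in \<omega>. h P n \<in> finpts Y \<and> fdist Y oY (h P n) \<le> 1 * m n"
        using fPfin am by eventually_elim (simp add: h_def a_def)
      with 2 show ?thesis using E.finseqsI hpts[OF S] by blast
    next
      case 3
      have "\<forall>\<^sub>F n in \<omega>. \<eta> (fdist X (r S n) (r N n) / fdist X (r P n) (r N n)) < \<eta> (?d S N / ?d P N) + 1"
        using ratio[OF S P(1) N P(2)] by (rule order_tendstoD) simp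
      then have "\<forall>\<^sub>F n in \<omega>. h S n \<in> finpts Y \<and> fdist Y oY (h S n) \<le> (\<eta> (?d S N / ?d P N) + 1) * m n"
        using triple[OF S P(1) N 3(2,1) P(2)] am
      proof eventually_elim
        case (elim n)
        have "f (r N n) = oY" using f by (simp add: rO pointed_map_def)
        then have "fdist Y oY (h S n) / m n < \<eta> (?d S N / ?d P N) + 1"
          using elim E.fin.commute by (simp add: h_def a_def)
        then show ?case using elim by (simp add: h_def field_simps)
      qed
      then show ?thesis using E.finseqsI hpts[OF S] by blast
    qed
  qed
  define g where "g S = cone_rel Y oY \<omega> m `` {h S}" for S
  have gfin: "g S \<in> finpts E.C" if "S \<in> finpts A.C" for S
    unfolding g_def by (intro E.class_in_finpts hfin that)
  have hg: "h S \<in> g S" if "S \<in> finpts A.C" for S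
    unfolding g_def using E.rel_iff[OF hfin[OF that]] hfin[OF that] E.D_self[OF hpts[OF that]] by simp
  have hlim: "((\<lambda>n. fdist Y (h S n) (h T n) / m n) \<longlongrightarrow> ?e (g S) (g T)) \<omega>"
    if "S \<in> finpts A.C" "T \<in> finpts A.C" for S T
    using E.scaled_fdist_tendsto[OF hfin hfin] E.fdist_cone[OF gfin hg gfin hg] that by simp
  \<comment> \<open>The limit of \<open>triple\<close> after multiplying by the denominator, because
    the limiting distance of \<open>g T\<close> and \<open>g Q\<close> is not yet known to be
    nonzero.\<close>
  have qs: "?e (g S) (g Q) \<le> \<eta> (?d S Q / ?d T Q) * ?e (g T) (g Q)"
    if "S \<in> finpts A.C" "T \<in> finpts A.C" "Q \<in> finpts A.C" "S \<noteq> T" "S \<noteq> Q" "T \<noteq> Q" for S T Q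
  proof (rule tendsto_le[OF A.nontrivial tendsto_mult[OF ratio hlim] hlim])
    show "\<forall>\<^sub>F n in \<omega>. fdist Y (h S n) (h Q n) / m n \<le>
        \<eta> (fdist X (r S n) (r Q n) / fdist X (r T n) (r Q n)) * (fdist Y (h T n) (h Q n) / m n)"
      using triple[OF that]
    proof eventually_elim
      case (elim n)
      then have "fdist Y (h T n) (h Q n) > 0"
        by (simp add: E.fin.mdist_pos_eq h_def)
      with elim have "fdist Y (h S n) (h Q n) \<le>
          \<eta> (fdist X (r S n) (r Q n) / fdist X (r T n) (r Q n)) * fdist Y (h T n) (h Q n)"
        unfolding h_def by (metis pos_divide_less_eq less_imp_le)
      then show ?case using divide_right_mono[OF _ less_imp_le[OF E.l_pos[of n]]] by fastforce
    qed
  qed (use that in auto)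
  \<comment> \<open>The scale is eventually the distance from \<open>oY\<close> to the image of the
    representative of \<open>P\<close>; this keeps \<open>g\<close> from being constant.\<close>
  have eOP: "?e (g N) (g P) = 1"
  proof (rule tendsto_unique[OF A.nontrivial hlim[OF N P(1)]])
    show "((\<lambda>n. fdist Y (h N n) (h P n) / m n) \<longlongrightarrow> 1) \<omega>"
      by (rule tendsto_eventually) (use am in eventually_elim, unfold hO, simp add: h_def a_def)
  qed
  have "inj_on g (finpts A.C)"
  proof (rule inj_onI, rule ccontr)
    fix S T assume ST: "S \<in> finpts A.C" "T \<in> finpts A.C" "g S = g T" "S \<noteq> T"
    \<comment> \<open>With \<open>S\<close> as comparison point the right side of \<open>qs\<close>
      contains the distance of \<open>g S\<close> and \<open>g T\<close>, which is 0, so all of the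
      cone collapses.\<close>
    have "g Q = g T" if Q: "Q \<in> finpts A.C" for Q
    proof (cases "Q = S \<or> Q = T")
      case False
      then have "?e (g Q) (g T) \<le> 0"
        using qs[OF Q ST(1,2)] ST gfin by simp
      then show ?thesis using ME.zero[OF gfin[OF Q] gfin[OF ST(2)]] ME.nonneg by (metis order_antisym)
    qed (use ST in auto)
    then have "g N = g P" using N P by simp
    then show False using eOP gfin[OF P(1)] by simp
  qed
  moreover have "continuous_map MC.mtopology ME.mtopology g"
    unfolding MC.metric_continuous_map[OF ME.Metric_space_axioms]
  proof (intro conjI ballI allI impI)
    show "g ` finpts A.C \<subseteq> finpts E.C" using gfin by blast
    fix Q and \<epsilon> :: real assume Q: "Q \<in> finpts A.C" and \<epsilon>: "\<epsilon> > 0"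
    \<comment> \<open>A fixed comparison point: as \<open>S\<close> approaches \<open>Q\<close>, the
      ratio of the distances of \<open>S\<close> and \<open>T\<close> from \<open>Q\<close> tends to
      0, and so does its image under \<open>\<eta>\<close>.\<close>
    obtain T where T: "T \<in> finpts A.C" "T \<noteq> Q" using N P by metis
    define k where "k = ?e (g T) (g Q)"
    have k: "k \<ge> 0" by (simp add: k_def)
    have dTQ: "?d T Q > 0" using MC.mdist_pos_eq T Q by simp
    obtain \<delta> where \<delta>: "\<delta> > 0" "\<And>t. t \<ge> 0 \<Longrightarrow> t < \<delta> \<Longrightarrow> \<bar>\<eta> t\<bar> < \<epsilon> / (k + 1)"
      using \<eta>c[unfolded continuous_on_iff, rule_format, of 0 "\<epsilon> / (k + 1)"] \<epsilon> k \<eta>0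
      by (auto simp: dist_real_def)
    \<comment> \<open>The second bound on the distance excludes \<open>S = T\<close>, as
      \<open>qs\<close> demands distinct points. Using \<open>k + 1\<close> avoids division by 0 and
      gives a strict inequality.\<close>
    have "?e (g Q) (g S) < \<epsilon>" if S: "S \<in> finpts A.C" "?d Q S < min (\<delta> * ?d T Q) (?d T Q)" for S
    proof (cases "S = Q")
      case True
      then show ?thesis using gfin[OF Q] \<epsilon> by simp
    next
      case False
      have "S \<noteq> T" using S MC.commute by auto
      then have "?e (g Q) (g S) \<le> \<eta> (?d S Q / ?d T Q) * k"
        using qs[OF S(1) T(1) Q] False T ME.commute by (simp add: k_def)
      also have "\<dots> \<le> \<epsilon> / (k + 1) * k"
      proof (rule mult_right_mono)
        have "?d S Q / ?d T Q < \<delta>" using S(2) dTQ MC.commute by (simp add: divide_less_eq)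
        then show "\<eta> (?d S Q / ?d T Q) \<le> \<epsilon> / (k + 1)"
          using \<delta>(2)[of "?d S Q / ?d T Q"] by simp
      qed (rule k)
      also have "\<dots> < \<epsilon>" using \<epsilon> k by (simp add: field_simps)
      finally show ?thesis .
    qed
    then show "\<exists>\<delta>>0. \<forall>S. S \<in> finpts A.C \<and> ?d Q S < \<delta> \<longrightarrow> ?e (g Q) (g S) < \<epsilon>"
      using \<delta>(1) dTQ by (intro exI[of _ "min (\<delta> * ?d T Q) (?d T Q)"]) auto
  qed
  ultimately show ?thesis using m by blast
qed

section \<open>Comparison of telescopic dimensions\<close>

theorem theorem1p2:
  fixes X :: "'a ext_space" and Y :: "'b ext_space"
    and oX :: 'a and oY :: 'b and f :: "'a \<Rightarrow> 'b"
  assumes "ext_metric_space X" and "ext_metric_space Y"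
    and "oX \<in> finpts X" and "oY \<in> finpts Y"
    and "asymptotically_chained X oX"
    and "all_cones_CAT0 X oX" and "all_cones_CAT0 Y oY"
    and "pointed_map X oX Y oY f" and "AM_map X oX Y f" and "regular_map X Y f"
  shows "tele_dim X oX \<le> tele_dim Y oY"
proof -
  \<comment> \<open>Telescopic dimension is an infimum of bounds, so it suffices that each bound for
    \<open>Y\<close> is one for \<open>X\<close>.\<close>
  have "tele_dim_le X oX n" if n: "tele_dim_le Y oY n" for n
    unfolding tele_dim_le_def Let_def
  proof (intro allI impI)
    fix \<omega> l assume \<omega>l: "nonprincipal_ultrafilter \<omega> \<and> cone_scale \<omega> l"
    let ?C = "asymptotic_cone X oX \<omega> l"
    have CX: "CAT0_space (finpts ?C) (fdist ?C)"
      using assms(6) \<omega>l unfolding all_cones_CAT0_def Let_def by blast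
    then have MC: "Metric_space (finpts ?C) (fdist ?C)" by (simp add: CAT0_space_def)
    have ME: "Metric_space (finpts (asymptotic_cone Y oY \<omega> m)) (fdist (asymptotic_cone Y oY \<omega> m))"
      if "cone_scale \<omega> m" for m
      using assms(7) \<omega>l that unfolding all_cones_CAT0_def Let_def CAT0_space_def by blast
    show "geom_dim (finpts ?C) (fdist ?C) \<le> enat n"
    proof (cases "finpts ?C \<subseteq> {cone_rel X oX \<omega> l `` {\<lambda>_. oX}}")
      case True
      then show ?thesis using geom_dim_subsingleton[OF MC] by simp
    next
      case False
      then obtain m g where m: "cone_scale \<omega> m" and g: "inj_on g (finpts ?C)"
        "continuous_map (fin_topology ?C) (fin_topology (asymptotic_cone Y oY \<omega> m)) g"
        using regular_AM_map_cone_embedding[OF assms(1-4,8-10) conjunct1[OF \<omega>l] conjunct2[OF \<omega>l] CX ME]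
        by blast
      have "geom_dim (finpts ?C) (fdist ?C) \<le>
          geom_dim (finpts (asymptotic_cone Y oY \<omega> m)) (fdist (asymptotic_cone Y oY \<omega> m))"
        using geom_dim_le_of_continuous_injection[OF MC ME[OF m] g(2,1)] .
      \<comment> \<open>The bound for \<open>Y\<close> ranges over all scales, hence covers the cone
        with the constructed \<open>m\<close>.\<close>
      also have "\<dots> \<le> enat n"
        using n \<omega>l m unfolding tele_dim_le_def Let_def by blast
      finally show ?thesis .
    qed
  qed
  then show ?thesis unfolding tele_dim_def by (intro INF_superset_mono) auto
qed

end
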